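(* For every integer $r\ge 3$, the $r$-dimensional Benes network satisfies $\beta'(B(r))=3\cdot 2^{r}$.
   Context: The Benes network $B(r)$ has vertex set $\{[s,i]: s\in\{0,1\}^r,\ i\in\{0,1,\dots,2r\}\}$ (so $2^r(2r+1)$ vertices). Writing $s=s_1\dots s_r$: for each $j\in\{1,\dots,r\}$, the vertices $[s,j-1]$ and $[s',j]$ are adjacent iff $s=s'$ or $s,s'$ differ exactly in bit $j$; and (the mirror image across level $r$) for each $j\in\{1,\dots,r\}$, the vertices $[s,2r-j]$ and $[s',2r-j+1]$ are adjacent iff $s=s'$ or $s,s'$ differ exactly in bit $j$; there are no other edges. For a connected graph $G$, a set $S\subseteq V(G)$ is a resolving set if for every pair of distinct vertices $a,b$ there is $u\in S$ with $d(a,u)\neq d(b,u)$ ($d$ the shortest-path distance); $S$ is a fault-tolerant resolving set if $S\setminus\{x\}$ is a resolving set for every $x\in S$; $\beta'(G)$ is the minimum cardinality of a fault-tolerant resolving set of $G$. *)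

theory Defs
  imports "Graph_Theory.Pair_Digraph" "Graph_Theory.Shortest_Path"
begin

text \<open>
  A finite simple graph is a \<open>pair_graph\<close>: an edge is a pair of opposite arcs.
\<close>

section \<open>Resolving sets\<close>

text \<open>
  Shortest-path distance is \<open>\<mu>\<close> with every arc of weight 1
  (it is \<open>\<infinity>\<close> between vertices of different components).
\<close>

definition graph_dist :: "'a pair_pre_digraph \<Rightarrow> 'a \<Rightarrow> 'a \<Rightarrow> ereal" where
  "graph_dist G u v = wf_digraph.\<mu> (with_proj G) (\<lambda>_. 1) u v"

definition resolving_set :: "'a pair_pre_digraph \<Rightarrow> 'a set \<Rightarrow> bool" where
  "resolving_set G S \<longleftrightarrow> S \<subseteq> pverts G \<and>
     (\<forall>a\<in>pverts G. \<forall>b\<in>pverts G. a \<noteq> b \<longrightarrow> (\<exists>u\<in>S. graph_dist G a u \<noteq> graph_dist G b u))"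

text \<open>
  For nonempty \<open>S \<subseteq> pverts G\<close> the first conjunct follows from the second; it keeps the empty set
  from being vacuously fault-tolerant.
\<close>

definition fault_tolerant_resolving_set :: "'a pair_pre_digraph \<Rightarrow> 'a set \<Rightarrow> bool" where
  "fault_tolerant_resolving_set G S \<longleftrightarrow>
     resolving_set G S \<and> (\<forall>x\<in>S. resolving_set G (S - {x}))"

text \<open>
  The value is 0 also when there is no finite fault-tolerant resolving set; a positive value
  is always attained.
\<close>

definition fault_tolerant_metric_dim :: "'a pair_pre_digraph \<Rightarrow> nat" where
  "fault_tolerant_metric_dim G = Inf (card ` {S. finite S \<and> fault_tolerant_resolving_set G S})"

section \<open>Benes networks\<close>

text \<open>
  The string \<open>s\<^sub>1\<dots>s\<^sub>r\<close> is a list of length \<open>r\<close>; bit \<open>j\<close>, counted from 1, is \<open>s ! (j - 1)\<close>.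
\<close>

definition differ_exactly_in_bit :: "nat \<Rightarrow> bool list \<Rightarrow> bool list \<Rightarrow> bool" where
  "differ_exactly_in_bit j s t \<longleftrightarrow> length s = length t \<and>
     (\<forall>k\<in>{1..length s}. s ! (k - 1) \<noteq> t ! (k - 1) \<longleftrightarrow> k = j)"

definition benes_verts :: "nat \<Rightarrow> (bool list \<times> nat) set" where
  "benes_verts r = {s. length s = r} \<times> {0..2 * r}"

text \<open>Edges directed from the lower to the higher level.\<close>

definition benes_up :: "nat \<Rightarrow> (bool list \<times> nat) rel" where
  "benes_up r = {((s, i), (t, i')). (s, i) \<in> benes_verts r \<and> (t, i') \<in> benes_verts r \<and>
     (\<exists>j\<in>{1..r}. (s = t \<or> differ_exactly_in_bit j s t) \<and>
        (i = j - 1 \<and> i' = j \<or> i = 2 * r - j \<and> i' = 2 * r - j + 1))}"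

definition benes :: "nat \<Rightarrow> (bool list \<times> nat) pair_pre_digraph" where
  "benes r = \<lparr> pverts = benes_verts r, parcs = benes_up r \<union> (benes_up r)\<inverse> \<rparr>"

lemma finite_benes_verts: "finite (benes_verts r)"
proof -
  have "{s :: bool list. length s = r} = {s. set s \<subseteq> UNIV \<and> length s = r}" by simp
  then show ?thesis
    unfolding benes_verts_def using finite_lists_length_eq[of "UNIV :: bool set" r] by simp
qed

lemma card_benes_verts: "card (benes_verts r) = 2 ^ r * (2 * r + 1)"
proof -
  have "{s :: bool list. length s = r} = {s. set s \<subseteq> UNIV \<and> length s = r}" by simp
  then show ?thesis
    unfolding benes_verts_def using card_lists_length_eq[of "UNIV :: bool set" r]
    by (simp add: card_cartesian_product)
qed

lemma pair_graph_benes: "pair_graph (benes r)"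
proof -
  have sub: "parcs (benes r) \<subseteq> benes_verts r \<times> benes_verts r"
    by (auto simp: benes_def benes_up_def)
  show ?thesis
  proof unfold_locales
    show "finite (parcs (benes r))"
      using finite_subset[OF sub] finite_benes_verts by blast
    show "finite (pverts (benes r))"
      by (simp add: benes_def finite_benes_verts)
    show "symmetric (with_proj (benes r))"
      by (auto simp: symmetric_def benes_def intro: symI)
  next
    fix e assume "e \<in> parcs (benes r)"
    then show "fst e \<in> pverts (benes r)" "snd e \<in> pverts (benes r)"
      using sub by (auto simp: benes_def)
    show "fst e \<noteq> snd e"
      using \<open>e \<in> parcs (benes r)\<close> by (auto simp: benes_def benes_up_def)
  qed
qed

end

theory Submission
  imports Defs
begin

text \<open>
  Two vertices with the same neighbours are resolved by no third vertex, so a fault-tolerant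
  resolving set contains both. In \<open>B(r)\<close> this applies to every vertex on the levels \<open>0\<close>, \<open>r\<close> and
  \<open>2r\<close>, which gives the lower bound.

  Conversely these levels suffice. The distance of two vertices is at least the difference of their
  levels, with equality iff a level-monotone path can correct all bits in which the two differ. This
  dichotomy alone yields, for any two vertices, two landmarks on the levels \<open>0\<close>, \<open>r\<close>, \<open>2r\<close> that
  resolve them.
\<close>

section \<open>Distances and twins\<close>

context pair_wf_digraph
begin

lemma awalk_cost_unit: "awalk_cost (\<lambda>_. 1) p = real (length p)"
  by (induction p) auto

lemma graph_dist_eq_INF: "graph_dist G u v = (INF p\<in>{p. awalk u p v}. ereal (length p))"
  by (simp add: graph_dist_def \<mu>_def awalk_cost_unit)

lemma graph_dist_le: "awalk u p v \<Longrightarrow> graph_dist G u v \<le> ereal (length p)"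
  unfolding graph_dist_eq_INF by (auto intro: INF_lower2)

lemma graph_dist_ge:
  assumes "\<And>p. awalk u p v \<Longrightarrow> n \<le> length p"
  shows "ereal n \<le> graph_dist G u v"
  unfolding graph_dist_eq_INF using assms by (auto intro: INF_greatest)

text \<open>Redirecting the first arc of a walk from \<open>a\<close> so that it starts at
  \<open>b\<close> gives a walk of the same length. The hypothesis \<open>u \<noteq> a\<close> rules
  out the empty walk, which has no first arc.\<close>

lemma graph_dist_twins_le:
  assumes "\<And>w. (a, w) \<in> parcs G \<Longrightarrow> (b, w) \<in> parcs G" and "u \<noteq> a"
  shows "graph_dist G b u \<le> graph_dist G a u"
proof -
  have "graph_dist G b u \<le> ereal (length p)" if p: "awalk a p u" for p
  proof (cases p)
    case Nil
    then show ?thesis using p assms(2) by (simp add: awalk_Nil_iff)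
  next
    case (Cons e q)
    then obtain w where "e = (a, w)" "(a, w) \<in> parcs G" "awalk w q u"
      using p by (cases e) (auto simp: awalk_Cons_iff)
    then have "awalk b ((b, w) # q) u"
      using assms(1) by (auto simp: awalk_Cons_iff)
    from graph_dist_le[OF this] show ?thesis using Cons by simp
  qed
  then show ?thesis
    by (subst (2) graph_dist_eq_INF) (auto intro: INF_greatest)
qed

lemma fault_tolerant_resolving_set_twin:
  assumes S: "fault_tolerant_resolving_set G S"
    and "a \<in> pverts G" "b \<in> pverts G" "a \<noteq> b"
    and nb: "\<And>w. (a, w) \<in> parcs G \<longleftrightarrow> (b, w) \<in> parcs G"
  shows "a \<in> S"
proof (rule ccontr)
  assume "a \<notin> S"
  \<comment> \<open>Fault tolerance speaks only of removing members of \<open>S\<close>; if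
    \<open>b\<close> is not one, then \<open>S - {b}\<close> is \<open>S\<close>.\<close>
  have "resolving_set G (S - {b})"
    using S by (cases "b \<in> S") (auto simp: fault_tolerant_resolving_set_def)
  then obtain u where u: "u \<in> S - {b}" "graph_dist G a u \<noteq> graph_dist G b u"
    using assms(2-4) unfolding resolving_set_def by meson
  moreover have "graph_dist G a u = graph_dist G b u"
    using u(1) \<open>a \<notin> S\<close> nb by (intro antisym graph_dist_twins_le) auto
  ultimately show False by simp
qed

end

text \<open>The distance formulas for \<open>benes\<close> expect the endpoint of lower level first,
  whereas a landmark stands second in the definition of resolving.\<close>

lemma (in pair_sym_digraph) graph_dist_sym: "graph_dist G u v = graph_dist G v u"
proof -
  have len: "length (rev_path p) = length p" for p :: "('a \<times> 'a) list"
    by (induction p) auto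
  have "graph_dist G u v \<le> ereal (length p)" if "awalk v p u" for u v p
    using graph_dist_le[OF awalk_rev_path'[OF that]] len by simp
  then have "graph_dist G u v \<le> graph_dist G v u" for u v
    unfolding graph_dist_eq_INF[of v u] by (auto intro: INF_greatest)
  then show ?thesis by (intro antisym)
qed

text \<open>Deleting one vertex leaves at least one of the two resolving vertices.\<close>

lemma fault_tolerant_resolving_setI:
  assumes "S \<subseteq> pverts G"
    and "\<And>a b. a \<in> pverts G \<Longrightarrow> b \<in> pverts G \<Longrightarrow> a \<noteq> b \<Longrightarrow>
      \<exists>u\<in>S. \<exists>v\<in>S. u \<noteq> v \<and> graph_dist G a u \<noteq> graph_dist G b u \<and> graph_dist G a v \<noteq> graph_dist G b v"
  shows "fault_tolerant_resolving_set G S"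
proof -
  have "\<exists>u\<in>S - {x}. graph_dist G a u \<noteq> graph_dist G b u"
    if "a \<in> pverts G" "b \<in> pverts G" "a \<noteq> b" for a b x
    using assms(2)[OF that] by blast
  then show ?thesis
    using assms(1) unfolding fault_tolerant_resolving_set_def resolving_set_def by blast
qed

section \<open>Distances in Benes networks\<close>

text \<open>The index (counted from 0) of the bit that may change between the levels \<open>l\<close> and \<open>l + 1\<close>.\<close>

definition level_bit :: "nat \<Rightarrow> nat \<Rightarrow> nat" where
  "level_bit r l = (if l < r then l else 2 * r - 1 - l)"

lemma level_bit_less: "l < 2 * r \<Longrightarrow> level_bit r l < r"
  by (auto simp: level_bit_def)

lemma mem_benes_verts: "(s, i) \<in> benes_verts r \<longleftrightarrow> length s = r \<and> i \<le> 2 * r"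
  by (auto simp: benes_verts_def)

lemma pverts_benes: "pverts (benes r) = benes_verts r"
  by (simp add: benes_def)

text \<open>Treats both halves of the network uniformly: one bit is free between consecutive levels,
  and leaving it free covers both equal strings and strings differing in that bit.\<close>

lemma benes_up_iff:
  "((s, l), (t, l')) \<in> benes_up r \<longleftrightarrow> length s = r \<and> length t = r \<and> l < 2 * r \<and> l' = Suc l \<and>
     (\<forall>k<r. k \<noteq> level_bit r l \<longrightarrow> s ! k = t ! k)" (is "?L \<longleftrightarrow> ?R")
proof
  assume ?L
  then obtain j where len: "length s = r" "length t = r" and j: "j \<in> {1..r}"
    and d: "s = t \<or> differ_exactly_in_bit j s t"
    and l: "l = j - 1 \<and> l' = j \<or> l = 2 * r - j \<and> l' = 2 * r - j + 1"
    by (auto simp: benes_up_def mem_benes_verts)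
  have lb: "level_bit r l = j - 1" using l j by (auto simp: level_bit_def)
  have "s ! k = t ! k" if "k < r" "k \<noteq> j - 1" for k
    using d
  proof
    assume "differ_exactly_in_bit j s t"
    then have "\<forall>k\<in>{1..length s}. s ! (k - 1) \<noteq> t ! (k - 1) \<longleftrightarrow> k = j"
      by (simp add: differ_exactly_in_bit_def)
    \<comment> \<open>List index \<open>k\<close> is bit \<open>k + 1\<close> of the
      definition.\<close>
    from bspec[OF this, of "Suc k"] show ?thesis using that len by auto
  qed simp
  then show ?R using len l j lb by auto
next
  assume R: ?R
  define b where "b = level_bit r l"
  have b: "b < r" using R level_bit_less by (simp add: b_def)
  have "s = t \<or> differ_exactly_in_bit (Suc b) s t"
  proof (cases "s ! b = t ! b")
    case True
    then have "s = t" using R by (intro nth_equalityI) (auto simp: b_def)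
    then show ?thesis ..
  next
    case False
    have "s ! k \<noteq> t ! k \<longleftrightarrow> k = b" if "k < r" for k
      using R False that unfolding b_def by blast
    then have "s ! (k - 1) \<noteq> t ! (k - 1) \<longleftrightarrow> k = Suc b" if "k \<in> {1..r}" for k
      using that by (cases k) auto
    then show ?thesis using R by (simp add: differ_exactly_in_bit_def)
  qed
  moreover have "l = Suc b - 1 \<and> l' = Suc b \<or> l = 2 * r - Suc b \<and> l' = 2 * r - Suc b + 1"
    using R by (auto simp: b_def level_bit_def)
  moreover have "Suc b \<in> {1..r}" using b by simp
  ultimately show ?L
    using R unfolding benes_up_def mem_Collect_eq case_prod_conv mem_benes_verts
    by (intro conjI bexI[of _ "Suc b"]) auto
qed

text \<open>Each arc changes the level by one. If the bound is attained, every arc goes up, so each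
  traversed level offers its own bit exactly once and no other bit changes.\<close>

lemma benes_walk_level:
  assumes "pre_digraph.awalk (with_proj (benes r)) (s, i) p (t, i')"
  shows "i' \<le> i + length p \<and>
    (i' = i + length p \<longrightarrow> (\<forall>k<r. s ! k \<noteq> t ! k \<longrightarrow> k \<in> level_bit r ` {i..<i'}))"
  using assms
proof (induction p arbitrary: s i)
  interpret pair_graph "benes r" by (rule pair_graph_benes)
  case Nil
  then show ?case by (auto simp: awalk_Nil_iff)
next
  interpret pair_graph "benes r" by (rule pair_graph_benes)
  case (Cons e p)
  obtain s' m where e: "e = ((s, i), (s', m))" "e \<in> parcs (benes r)" "awalk (s', m) p (t, i')"
    using Cons.prems by (cases e) (auto simp: awalk_Cons_iff)
  note IH = Cons.IH[OF e(3)]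
  have up: "m = Suc i \<and> (\<forall>k<r. k \<noteq> level_bit r i \<longrightarrow> s ! k = s' ! k) \<or> i = Suc m"
    using e(1,2) by (auto simp: benes_def benes_up_iff)
  show ?case
  proof (intro conjI impI allI)
    show "i' \<le> i + length (e # p)" using IH up by auto
    fix k assume *: "i' = i + length (e # p)" "k < r" "s ! k \<noteq> t ! k"
    \<comment> \<open>A first arc downwards would leave \<open>p\<close> too short to reach level
      \<open>i'\<close>.\<close>
    then have m: "m = Suc i" using IH up by auto
    show "k \<in> level_bit r ` {i..<i'}"
    proof (cases "k = level_bit r i")
      case True
      then show ?thesis using * by auto
    next
      case False
      then have "k \<in> level_bit r ` {m..<i'}" using IH up m * by auto
      then show ?thesis using m by auto
    qed
  qed
qed

text \<open>Greedy walk: between consecutive levels, set the free bit to its value in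
  \<open>t\<close>.\<close>

lemma benes_monotone_walk:
  assumes "i \<le> i'" "i' \<le> 2 * r" "length s = r" "length t = r"
    and "\<forall>k<r. s ! k \<noteq> t ! k \<longrightarrow> k \<in> level_bit r ` {i..<i'}"
  shows "\<exists>p. length p = i' - i \<and> pre_digraph.awalk (with_proj (benes r)) (s, i) p (t, i')"
  using assms
proof (induction i arbitrary: s rule: inc_induct)
  interpret pair_graph "benes r" by (rule pair_graph_benes)
  case base
  then have "s = t" by (auto intro: nth_equalityI)
  with base show ?case by (auto simp: awalk_Nil_iff mem_benes_verts pverts_benes)
next
  interpret pair_graph "benes r" by (rule pair_graph_benes)
  case (step i)
  let ?b = "level_bit r i"
  let ?s = "s[?b := t ! ?b]"
  have arc: "((s, i), (?s, Suc i)) \<in> parcs (benes r)"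
    using step by (auto simp: benes_def benes_up_iff)
  have "\<forall>k<r. ?s ! k \<noteq> t ! k \<longrightarrow> k \<in> level_bit r ` {Suc i..<i'}"
  proof (intro allI impI)
    fix k assume k: "k < r" "?s ! k \<noteq> t ! k"
    then have "k \<noteq> ?b" using step.prems by auto
    with k step.prems obtain l where "k = level_bit r l" "l \<in> {i..<i'}" by force
    then show "k \<in> level_bit r ` {Suc i..<i'}"
      using \<open>k \<noteq> ?b\<close> by (cases "l = i") auto
  qed
  with step.IH[of ?s] step.prems obtain p
    where "length p = i' - Suc i" "awalk (?s, Suc i) p (t, i')" by auto
  with arc step.hyps have "length (((s, i), (?s, Suc i)) # p) = i' - i"
    "awalk (s, i) (((s, i), (?s, Suc i)) # p) (t, i')" by (auto simp: awalk_Cons_iff)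
  then show ?case by blast
qed

lemma benes_dist_eq_iff:
  assumes "i \<le> i'" "i' \<le> 2 * r" "length s = r" "length t = r"
  shows "graph_dist (benes r) (s, i) (t, i') = ereal (i' - i) \<longleftrightarrow>
    (\<forall>k<r. s ! k \<noteq> t ! k \<longrightarrow> k \<in> level_bit r ` {i..<i'})" (is "?L \<longleftrightarrow> ?R")
proof
  interpret pair_graph "benes r" by (rule pair_graph_benes)
  assume ?R
  from benes_monotone_walk[OF assms this] have "graph_dist (benes r) (s, i) (t, i') \<le> ereal (i' - i)"
    using graph_dist_le by force
  moreover have "ereal (i' - i) \<le> graph_dist (benes r) (s, i) (t, i')"
    using benes_walk_level by (intro graph_dist_ge) fastforce
  ultimately show ?L by simp
next
  interpret pair_graph "benes r" by (rule pair_graph_benes)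
  assume ?L
  show ?R
  proof (rule ccontr)
    assume nR: "\<not> ?R"
    \<comment> \<open>A uniform gap of one keeps the inequality strict when passing to the infimum
      over all walks.\<close>
    have "ereal (Suc (i' - i)) \<le> graph_dist (benes r) (s, i) (t, i')"
    proof (rule graph_dist_ge)
      fix p assume "awalk (s, i) p (t, i')"
      from benes_walk_level[OF this] nR have "i' \<le> i + length p" "i' \<noteq> i + length p" by blast+
      then show "Suc (i' - i) \<le> length p" using assms(1) by simp
    qed
    then show False using \<open>?L\<close> by simp
  qed
qed

lemma benes_dist_lower_half:
  assumes "i \<le> i'" "i' \<le> r" "length s = r" "length t = r"
  shows "graph_dist (benes r) (s, i) (t, i') = ereal (i' - i) \<longleftrightarrow>
    (\<forall>k<r. s ! k \<noteq> t ! k \<longrightarrow> i \<le> k \<and> k < i')"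
proof -
  have "level_bit r ` {i..<i'} = {i..<i'}"
    using assms by (force simp: level_bit_def)
  then show ?thesis using assms by (subst benes_dist_eq_iff) auto
qed

text \<open>Above level \<open>r\<close> the free bit is the mirror image
  \<open>2 * r - 1 - l\<close>, so an interval of levels becomes a reversed interval of
  bits.\<close>

lemma benes_dist_upper_half:
  assumes "r \<le> i" "i \<le> i'" "i' \<le> 2 * r" "length s = r" "length t = r"
  shows "graph_dist (benes r) (s, i) (t, i') = ereal (i' - i) \<longleftrightarrow>
    (\<forall>k<r. s ! k \<noteq> t ! k \<longrightarrow> 2 * r - i' \<le> k \<and> k < 2 * r - i)"
proof -
  have "k \<in> level_bit r ` {i..<i'} \<longleftrightarrow> 2 * r - i' \<le> k \<and> k < 2 * r - i" if "k < r" for k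
  proof
    assume "2 * r - i' \<le> k \<and> k < 2 * r - i"
    then show "k \<in> level_bit r ` {i..<i'}"
      using assms that by (intro image_eqI[of _ _ "2 * r - 1 - k"]) (auto simp: level_bit_def)
  qed (use assms in \<open>auto simp: level_bit_def\<close>)
  then show ?thesis using assms by (subst benes_dist_eq_iff) auto
qed

text \<open>Such a path traverses one whole half, where every bit is free once, so the strings do
  not matter.\<close>

lemma benes_dist_across:
  assumes "i \<le> r" "r \<le> i'" "i' \<le> 2 * r" "i = 0 \<or> i' = 2 * r" "length s = r" "length t = r"
  shows "graph_dist (benes r) (s, i) (t, i') = ereal (i' - i)"
proof -
  have "k \<in> level_bit r ` {i..<i'}" if "k < r" for k
  proof (cases "i = 0")
    case True
    then show ?thesis using assms that by (intro image_eqI[of _ _ k]) (auto simp: level_bit_def)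
  next
    case False
    then show ?thesis
      using assms that by (intro image_eqI[of _ _ "2 * r - 1 - k"]) (auto simp: level_bit_def)
  qed
  then show ?thesis using assms by (subst benes_dist_eq_iff) auto
qed

section \<open>The landmarks\<close>

definition landmarks :: "nat \<Rightarrow> (bool list \<times> nat) set" where
  "landmarks r = {s. length s = r} \<times> {0, r, 2 * r}"

lemma card_landmarks:
  assumes "r > 0"
  shows "card (landmarks r) = 3 * 2 ^ r"
proof -
  have "{s :: bool list. length s = r} = {s. set s \<subseteq> UNIV \<and> length s = r}" by simp
  then show ?thesis
    using assms card_lists_length_eq[of "UNIV :: bool set" r]
    by (simp add: landmarks_def card_cartesian_product)
qed

lemma landmarks_subset_verts: "landmarks r \<subseteq> benes_verts r"
  by (auto simp: landmarks_def mem_benes_verts)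

section \<open>Lower bound: every landmark is forced\<close>

abbreviation flip_bit :: "nat \<Rightarrow> bool list \<Rightarrow> bool list" where
  "flip_bit k s \<equiv> s[k := \<not> s ! k]"

lemma flip_bit_neq: "k < length s \<Longrightarrow> flip_bit k s \<noteq> s"
  by (metis nth_list_update_eq)

lemma landmarks_subset_fault_tolerant:
  assumes "r > 0" and S: "fault_tolerant_resolving_set (benes r) S"
  shows "landmarks r \<subseteq> S"
proof
  interpret pair_graph "benes r" by (rule pair_graph_benes)
  fix a assume "a \<in> landmarks r"
  then obtain s i where a: "a = (s, i)" and s: "length s = r" and i: "i \<in> {0, r, 2 * r}"
    by (auto simp: landmarks_def)
  \<comment> \<open>On these three levels all incident arcs leave the same bit free: bit 0 at both
    ends, and bit \<open>r - 1\<close> on either side of level \<open>r\<close>. Flipping it gives a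
    twin.\<close>
  define c where "c = (if i = r then r - 1 else 0)"
  have c: "c < r" using assms(1) by (simp add: c_def)
  have up: "level_bit r i = c" if "i < 2 * r"
    using that i assms(1) by (auto simp: level_bit_def c_def)
  have down: "level_bit r l = c" if "i = Suc l" for l
    using that i assms(1) by (auto simp: level_bit_def c_def)
  have "((s, i), w) \<in> parcs (benes r) \<longleftrightarrow> ((flip_bit c s, i), w) \<in> parcs (benes r)" for w
    using s up down by (cases w) (auto simp: benes_def benes_up_iff)
  then show "a \<in> S"
    using i s flip_bit_neq[of c s] c unfolding a
    by (intro fault_tolerant_resolving_set_twin[OF S, of _ "(flip_bit c s, i)"])
      (auto simp: pverts_benes mem_benes_verts)
qed

section \<open>Upper bound: two resolving landmarks for each pair\<close>

lemma landmarks_resolve_twice: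
  assumes r: "r \<ge> 2" and s: "length s = r" and s': "length s' = r"
    and i: "i \<le> i'" and i': "i' \<le> 2 * r" and neq: "(s, i) \<noteq> (s', i')"
  shows "\<exists>u\<in>landmarks r. \<exists>v\<in>landmarks r. u \<noteq> v \<and>
    graph_dist (benes r) (s, i) u \<noteq> graph_dist (benes r) (s', i') u \<and>
    graph_dist (benes r) (s, i) v \<noteq> graph_dist (benes r) (s', i') v" (is ?thesis)
proof -
  interpret pair_graph "benes r" by (rule pair_graph_benes)
  let ?d = "graph_dist (benes r)"
  note lm = landmarks_def
  have [simp]: "s \<noteq> []" "s' \<noteq> []" using r s s' by auto
  \<comment> \<open>The two landmarks are mostly found as a string and its flip on one level, the
    flipped bit being one that cannot affect the comparison of distances.\<close>
  have flip: "?thesis"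
    if "\<And>u. u \<in> {t, flip_bit k t} \<Longrightarrow> ?d (s, i) (u, l) \<noteq> ?d (s', i') (u, l)"
      "l \<in> {0, r, 2 * r}" "length t = r" "k < r" for t k l
  proof (intro bexI conjI)
    show "(t, l) \<noteq> (flip_bit k t, l)" using flip_bit_neq[of k t] that by auto
  qed (use that in \<open>auto simp: lm\<close>)
  have self: "?d (t, l) (t, l) = 0" if "length t = r" "l \<le> 2 * r" for t l
    using benes_dist_eq_iff[of l l r t t] that by simp
  have pos: "?d x y \<noteq> 0" if xy: "x \<noteq> y" for x y
  proof -
    have "ereal (real 1) \<le> ?d x y"
    proof (rule graph_dist_ge)
      fix p assume "awalk x p y"
      then show "1 \<le> length p" using xy by (cases p) (auto simp: awalk_Nil_iff)
    qed
    then show ?thesis by auto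
  qed
  \<comment> \<open>Both vertices are landmarks here, and each is resolved from the other by itself
    and by the other.\<close>
  have ends: ?thesis if "i \<in> {0, r, 2 * r}" "i' \<in> {0, r, 2 * r}"
  proof (intro bexI conjI)
    show "?d (s, i) (s, i) \<noteq> ?d (s', i') (s, i)"
      using self[of s i] pos[of "(s', i')" "(s, i)"] neq i i' s by auto
    show "?d (s, i) (s', i') \<noteq> ?d (s', i') (s', i')"
      using self[of s' i'] pos[of "(s, i)" "(s', i')"] neq i' s' by auto
  qed (use neq that s s' in \<open>auto simp: lm\<close>)
  consider (both_lower) "i < i'" "i' \<le> r" | (both_upper) "i < i'" "r \<le> i"
    | (cross) "i < r" "r < i'" | (level) "i = i'" using i by linarith
  then show ?thesis
  proof cases
    \<comment> \<open>Every landmark on level \<open>2 * r\<close> sees the two vertices at their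
      level differences, which are distinct. The next case is the mirror image.\<close>
    case both_lower
    show ?thesis
      by (rule flip[of s 0 "2 * r"])
        (use both_lower r s s' in \<open>auto simp: benes_dist_across\<close>)
  next
    case both_upper
    show ?thesis
      by (rule flip[of s 0 0])
        (use both_upper r s s' i' in \<open>auto simp: graph_dist_sym[of _ "(_, 0)"] benes_dist_across\<close>)
  next
    case cross
    \<comment> \<open>If \<open>i > 0\<close>, bit 0 can be corrected below level \<open>i\<close>,
      so both chosen landmarks on level 0 are at distance \<open>i\<close> from
      \<open>(s, i)\<close>, but at distance \<open>i'\<close> from the other vertex, across the
      middle. If \<open>i' < 2 * r\<close>, the mirror image works from level
      \<open>2 * r\<close>.\<close>
    consider "i = 0" "i' = 2 * r" | "i > 0" | "i' < 2 * r" using i' by linarith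
    then show ?thesis
    proof cases
      case 1
      then show ?thesis by (intro ends) auto
    next
      case 2
      show ?thesis
      proof (rule flip[of s 0 0])
        fix u assume u: "u \<in> {s, flip_bit 0 s}"
        have "?d (u, 0) (s, i) = ereal (i - 0)"
          using u 2 cross s by (subst benes_dist_lower_half) (auto simp: nth_list_update split: if_splits)
        moreover have "?d (u, 0) (s', i') = ereal (i' - 0)"
          using u cross s s' i' by (intro benes_dist_across) auto
        ultimately show "?d (s, i) (u, 0) \<noteq> ?d (s', i') (u, 0)"
          using cross by (simp add: graph_dist_sym[of _ "(u, 0)"])
      qed (use s r in auto)
    next
      case 3
      show ?thesis
      proof (rule flip[of s' 0 "2 * r"])
        fix u assume u: "u \<in> {s', flip_bit 0 s'}"
        have "?d (s', i') (u, 2 * r) = ereal (2 * r - i')"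
          using u 3 cross s' by (subst benes_dist_upper_half) (auto simp: nth_list_update split: if_splits)
        moreover have "?d (s, i) (u, 2 * r) = ereal (2 * r - i)"
          using u cross s s' by (intro benes_dist_across) auto
        ultimately show "?d (s, i) (u, 2 * r) \<noteq> ?d (s', i') (u, 2 * r)"
          using cross i' by simp
      qed (use s' r in auto)
    qed
  next
    case level
    with neq have "s \<noteq> s'" by simp
    then obtain k where k: "k < r" "s ! k \<noteq> s' ! k"
      using s s' nth_equalityI[of s s'] by auto
    \<comment> \<open>Look from an end of the half such that bit \<open>k\<close> is not free on the
      way: an outer level or level \<open>r\<close>. The bit that is free next to this end, 0 or
      \<open>r - 1\<close>, is then not \<open>k\<close>; flipping it in \<open>s\<close> preserves
      the exact distance to \<open>(s, i)\<close> and the disagreement with \<open>s'\<close> at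
      \<open>k\<close>.\<close>
    consider "i \<in> {0, r, 2 * r}" | (outer_lower) "0 < i" "i < r" "i \<le> k"
      | (inner_lower) "0 < i" "i < r" "k < i"
      | (outer_upper) "r < i" "i < 2 * r" "2 * r - i \<le> k"
      | (inner_upper) "r < i" "i < 2 * r" "k < 2 * r - i"
      using i i' level by fastforce
    then show ?thesis
    proof cases
      case 1
      then show ?thesis using level ends by blast
    next
      case outer_lower
      show ?thesis
      proof (rule flip[of s 0 0])
        fix u assume u: "u \<in> {s, flip_bit 0 s}"
        have "?d (u, 0) (s, i) = ereal (i - 0)"
          using u outer_lower s
          by (subst benes_dist_lower_half) (auto simp: nth_list_update split: if_splits)
        moreover have "?d (u, 0) (s', i) \<noteq> ereal (i - 0)"
          using u outer_lower s s' k
          by (subst benes_dist_lower_half) (auto intro!: exI[of _ k])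
        ultimately show "?d (s, i) (u, 0) \<noteq> ?d (s', i') (u, 0)"
          using level by (simp add: graph_dist_sym[of _ "(u, 0)"])
      qed (use s r in auto)
    next
      case inner_lower
      show ?thesis
      proof (rule flip[of s "r - 1" r])
        fix u assume u: "u \<in> {s, flip_bit (r - 1) s}"
        have "?d (s, i) (u, r) = ereal (r - i)"
          using u inner_lower s
          by (subst benes_dist_lower_half) (auto simp: nth_list_update split: if_splits)
        moreover have "?d (s', i) (u, r) \<noteq> ereal (r - i)"
          using u inner_lower s s' k
          by (subst benes_dist_lower_half) (auto intro!: exI[of _ k])
        ultimately show "?d (s, i) (u, r) \<noteq> ?d (s', i') (u, r)"
          using level by simp
      qed (use s r in auto)
    next
      case outer_upper
      show ?thesis
      proof (rule flip[of s 0 "2 * r"])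
        fix u assume u: "u \<in> {s, flip_bit 0 s}"
        have "?d (s, i) (u, 2 * r) = ereal (2 * r - i)"
          using u outer_upper s
          by (subst benes_dist_upper_half) (auto simp: nth_list_update split: if_splits)
        moreover have "?d (s', i) (u, 2 * r) \<noteq> ereal (2 * r - i)"
          using u outer_upper s s' k
          by (subst benes_dist_upper_half) (auto intro!: exI[of _ k])
        ultimately show "?d (s, i) (u, 2 * r) \<noteq> ?d (s', i') (u, 2 * r)"
          using level by simp
      qed (use s r in auto)
    next
      case inner_upper
      show ?thesis
      proof (rule flip[of s "r - 1" r])
        fix u assume u: "u \<in> {s, flip_bit (r - 1) s}"
        have "?d (u, r) (s, i) = ereal (i - r)"
          using u inner_upper s
          by (subst benes_dist_upper_half) (auto simp: nth_list_update split: if_splits)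
        moreover have "?d (u, r) (s', i) \<noteq> ereal (i - r)"
          using u inner_upper s s' k
          by (subst benes_dist_upper_half) (auto intro!: exI[of _ k])
        ultimately show "?d (s, i) (u, r) \<noteq> ?d (s', i') (u, r)"
          using level by (simp add: graph_dist_sym[of _ "(u, r)"])
      qed (use s r in auto)
    qed
  qed
qed

lemma landmarks_fault_tolerant:
  assumes "r \<ge> 2"
  shows "fault_tolerant_resolving_set (benes r) (landmarks r)"
proof (rule fault_tolerant_resolving_setI)
  show "landmarks r \<subseteq> pverts (benes r)"
    using landmarks_subset_verts by (simp add: pverts_benes)
  fix a b assume ab: "a \<in> pverts (benes r)" "b \<in> pverts (benes r)" "a \<noteq> b"
  obtain s i s' i' where [simp]: "a = (s, i)" "b = (s', i')" by (cases a, cases b)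
  have *: "length s = r" "i \<le> 2 * r" "length s' = r" "i' \<le> 2 * r"
    using ab by (auto simp: pverts_benes mem_benes_verts)
  show "\<exists>u\<in>landmarks r. \<exists>v\<in>landmarks r. u \<noteq> v \<and>
    graph_dist (benes r) a u \<noteq> graph_dist (benes r) b u \<and>
    graph_dist (benes r) a v \<noteq> graph_dist (benes r) b v"
  proof (cases "i \<le> i'")
    case True
    then show ?thesis using landmarks_resolve_twice[OF assms, of s s' i i'] * ab(3) by simp
  next
    case False
    then show ?thesis using landmarks_resolve_twice[OF assms, of s' s i' i] * ab(3) by fastforce
  qed
qed

theorem theorem3p2:
  fixes r :: nat
  assumes "r \<ge> 3"
  shows "fault_tolerant_metric_dim (benes r) = 3 * 2 ^ r"
  unfolding fault_tolerant_metric_dim_def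
proof (rule cInf_eq_minimum)
  have "finite (landmarks r)"
    using finite_subset[OF landmarks_subset_verts finite_benes_verts] .
  then show "3 * 2 ^ r \<in> card ` {S. finite S \<and> fault_tolerant_resolving_set (benes r) S}"
    using landmarks_fault_tolerant[of r] card_landmarks[of r] assms
    by (intro image_eqI[of _ _ "landmarks r"]) auto
next
  fix n assume "n \<in> card ` {S. finite S \<and> fault_tolerant_resolving_set (benes r) S}"
  \<comment> \<open>Finiteness of \<open>S\<close> turns the inclusion of the landmarks into an
    inequality of cardinalities.\<close>
  then obtain S where "n = card S" "finite S" "fault_tolerant_resolving_set (benes r) S" by auto
  then show "3 * 2 ^ r \<le> n"
    using landmarks_subset_fault_tolerant[of r S] card_landmarks[of r] card_mono[of S "landmarks r"] assms
    by simp
qed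

end
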